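(* Let $M\in\mathbb{S}_n^{++}$ and $N\in\mathbb{S}_n^{+}$, and let $$\varphi(M,N):=-\operatorname{tr}\big((\sqrt{M}\,N\sqrt{M})^{1/2}\big).$$ Then $$\varphi(M,N)=\min_{L\in\mathcal M(N,M)}\,-\operatorname{tr}(L),\qquad \mathcal M(N,M)=\left\{L\in\mathbb{S}_n^{+}\ \middle|\ \begin{bmatrix}N & M^{-1/2}L\\ LM^{-1/2} & I_n\end{bmatrix}\succeq 0\right\}.$$
   Context: $\mathbb{S}_n^{+}$ and $\mathbb{S}_n^{++}$ denote the real symmetric positive semidefinite and positive definite $n\times n$ matrices; $\sqrt{X}=X^{1/2}$ is the unique positive semidefinite square root of $X\in\mathbb{S}_n^+$; $I_n$ is the identity matrix; $X\succeq 0$ means $X$ is symmetric positive semidefinite. *)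

theory Defs
  imports "HOL-Analysis.Analysis"
begin

definition psd :: "real^'n^'n \<Rightarrow> bool" where
  "psd A \<longleftrightarrow> transpose A = A \<and> (\<forall>x. x \<bullet> (A *v x) \<ge> 0)"

definition pd :: "real^'n^'n \<Rightarrow> bool" where
  "pd A \<longleftrightarrow> transpose A = A \<and> (\<forall>x. x \<noteq> 0 \<longrightarrow> x \<bullet> (A *v x) > 0)"

(* Only meaningful for positive semidefinite A; elsewhere THE returns an unspecified value. *)
definition msqrt :: "real^'n^'n \<Rightarrow> real^'n^'n" where
  "msqrt A = (THE B. psd B \<and> B ** B = A)"

(* [A B; C D]; a block index is Inl i (first block) or Inr j (second block). *)
definition block_matrix ::
  "real^'n^'m \<Rightarrow> real^'k^'m \<Rightarrow> real^'n^'l \<Rightarrow> real^'k^'l \<Rightarrow> real^('n + 'k)^('m + 'l)" where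
  "block_matrix A B C D = (\<chi> i j.
     case i of
       Inl a \<Rightarrow> (case j of Inl b \<Rightarrow> A $ a $ b | Inr b \<Rightarrow> B $ a $ b)
     | Inr a \<Rightarrow> (case j of Inl b \<Rightarrow> C $ a $ b | Inr b \<Rightarrow> D $ a $ b))"

definition \<phi> :: "real^'n^'n \<Rightarrow> real^'n^'n \<Rightarrow> real" where
  "\<phi> M N = - trace (msqrt (msqrt M ** N ** msqrt M))"

(* The power M^(-1/2) is rendered as the inverse of the square root of M. *)
definition feasible :: "real^'n^'n \<Rightarrow> real^'n^'n \<Rightarrow> (real^'n^'n) set" where
  "feasible N M =
     {L. psd L \<and>
         psd (block_matrix N (matrix_inv (msqrt M) ** L)
                           (L ** matrix_inv (msqrt M)) (mat 1))}"

end

theory Submission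
  imports Defs
begin

text \<open>
  Write $S = \sqrt M$, which is invertible because $M$ is positive definite, and
  $K = (S N S)^{1/2}$. Taking the Schur complement of the identity block, the block matrix in the
  constraint is positive semidefinite exactly when $\|L S^{-1} x\|^2 \le x \cdot N x$ for all $x$.
  The substitution $x = S z$ turns the right-hand side into $z \cdot S N S z = \|K z\|^2$,
  so the constraint says that $\|L z\| \le \|K z\|$ for all $z$
  (\<open>feasible_iff_norm_le\<close>).

  Now $L = K$ is feasible, and it attains the claimed value. For any other feasible $L$, sum over
  an orthonormal basis $E$ of eigenvectors of $K$: the eigenvalue at $e$ is $\|K e\|$ because $K$ is
  positive semidefinite, so Cauchy-Schwarz gives
  $\mathrm{tr}\, L = \sum_e e \cdot L e \le \sum_e \|L e\| \le \sum_e \|K e\| = \mathrm{tr}\, K$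
  (\<open>trace_le_if_norm_le\<close>).

  The foundation is the spectral theorem for real symmetric matrices. It is obtained by maximising
  the Rayleigh quotient on invariant subspaces, and it yields existence and uniqueness of the
  positive semidefinite square root.
\<close>

section \<open>The spectral theorem for self-adjoint maps\<close>

lemma linear_coeff_eq_0_if_quadratic_nonneg:
  fixes a b :: real
  assumes nonneg: "\<And>t. 0 \<le> 2 * t * a + t\<^sup>2 * b"
  shows "a = 0"
proof (rule ccontr)
  assume "a \<noteq> 0"
  define c where "c = \<bar>b\<bar> + 1"
  have c: "c > 0" "b < 2 * c" by (auto simp: c_def)
  have "2 * (- a / c) * a + (- a / c)\<^sup>2 * b = (a / c)\<^sup>2 * (b - 2 * c)"
    using c by (simp add: field_simps power2_eq_square)
  moreover have "(a / c)\<^sup>2 * (b - 2 * c) < 0"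
    using c \<open>a \<noteq> 0\<close> by (intro mult_pos_neg) auto
  ultimately show False using nonneg[of "- a / c"] by linarith
qed

text \<open>
  A unit vector $e$ of the subspace that maximises $x \cdot f x$, with maximum $\mu$, is an
  eigenvector. Indeed $\mu \|x\|^2 - x \cdot f x$ is nonnegative on the subspace and vanishes at
  $e$, hence its derivative at $e$ vanishes in every direction $w$ of the subspace. The
  direction $w = \mu e - f e$ is admissible by invariance.
\<close>
lemma self_adjoint_eigenvector_exists:
  fixes f :: "'a::euclidean_space \<Rightarrow> 'a"
  assumes lin: "linear f" and adj: "\<And>x y. f x \<bullet> y = x \<bullet> f y"
    and sub: "subspace V" and inv: "\<And>x. x \<in> V \<Longrightarrow> f x \<in> V" and nontriv: "V \<noteq> {0}"
  obtains e \<mu> where "e \<in> V" "norm e = 1" "f e = \<mu> *\<^sub>R e"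
proof -
  let ?K = "sphere 0 1 \<inter> V"
  have "compact ?K"
    by (intro compact_Int_closed closed_subspace sub) auto
  moreover have "?K \<noteq> {}"
  proof -
    obtain v where v: "v \<in> V" "v \<noteq> 0" using nontriv subspace_0[OF sub] by blast
    then have "v /\<^sub>R norm v \<in> ?K" using sub by (simp add: subspace_scale)
    then show ?thesis by blast
  qed
  moreover have "continuous_on ?K (\<lambda>x. x \<bullet> f x)"
    by (intro continuous_intros linear_continuous_on linear_conv_bounded_linear[THEN iffD1] lin)
  ultimately obtain e where e: "e \<in> ?K" and max: "\<And>x. x \<in> ?K \<Longrightarrow> x \<bullet> f x \<le> e \<bullet> f e"
    using continuous_attains_sup[of ?K "\<lambda>x. x \<bullet> f x"] by blast
  define \<mu> where "\<mu> = e \<bullet> f e"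
  have ee: "e \<bullet> e = 1" using e by (simp add: dot_square_norm)
  have bound: "x \<bullet> f x \<le> \<mu> * (x \<bullet> x)" if "x \<in> V" for x
  proof (cases "x = 0")
    case False
    then have "x /\<^sub>R norm x \<in> ?K" using that sub by (simp add: subspace_scale)
    from max[OF this] have "(x \<bullet> f x) / (norm x)\<^sup>2 \<le> \<mu>"
      by (simp add: \<mu>_def linear_scale[OF lin] power2_eq_square field_simps)
    then show ?thesis using False by (simp add: dot_square_norm field_simps)
  qed simp
  define w where "w = \<mu> *\<^sub>R e - f e"
  have wV: "w \<in> V" using e inv sub by (simp add: w_def subspace_diff subspace_scale)
  have "0 \<le> 2 * t * (w \<bullet> w) + t\<^sup>2 * (\<mu> * (w \<bullet> w) - w \<bullet> f w)" for t
  proof -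
    have "e + t *\<^sub>R w \<in> V" using e wV sub by (simp add: subspace_add subspace_scale)
    from bound[OF this]
    have "e \<bullet> f e + 2 * t * (w \<bullet> f e) + t\<^sup>2 * (w \<bullet> f w)
        \<le> \<mu> * (e \<bullet> e + 2 * t * (w \<bullet> e) + t\<^sup>2 * (w \<bullet> w))"
      using adj[of e w]
      by (simp add: linear_add[OF lin] linear_scale[OF lin] inner_simps inner_commute
          power2_eq_square algebra_simps)
    moreover have "2 * t * (w \<bullet> w) = 2 * t * (\<mu> * (w \<bullet> e)) - 2 * t * (w \<bullet> f e)"
      by (subst (2) w_def) (simp add: inner_simps algebra_simps)
    ultimately show ?thesis
      using ee by (simp add: \<mu>_def[symmetric] algebra_simps)
  qed
  then have "w \<bullet> w = 0" by (rule linear_coeff_eq_0_if_quadratic_nonneg)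
  then have "f e = \<mu> *\<^sub>R e" by (simp add: w_def)
  then show thesis using e that by auto
qed

definition orthonormal :: "'a::real_inner set \<Rightarrow> bool" where
  "orthonormal E \<longleftrightarrow> pairwise orthogonal E \<and> (\<forall>e\<in>E. norm e = 1)"

text \<open>
  Induction on the dimension: once an eigenvector $e$ is split off, its orthogonal complement in
  the subspace is again invariant, by self-adjointness, and has smaller dimension.
\<close>
lemma self_adjoint_eigenbasis_subspace:
  fixes f :: "'a::euclidean_space \<Rightarrow> 'a"
  assumes lin: "linear f" and adj: "\<And>x y. f x \<bullet> y = x \<bullet> f y"
    and "subspace V" and "\<And>x. x \<in> V \<Longrightarrow> f x \<in> V"
  shows "\<exists>E. orthonormal E \<and> span E = V \<and> (\<forall>e\<in>E. \<exists>\<mu>. f e = \<mu> *\<^sub>R e)"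
  using assms(3,4)
proof (induction "dim V" arbitrary: V rule: less_induct)
  case less
  note sub = less.prems(1) and inv = less.prems(2)
  show ?case
  proof (cases "V = {0}")
    case True
    then show ?thesis by (intro exI[of _ "{}"]) (simp add: orthonormal_def)
  next
    case False
    obtain e \<mu> where e: "e \<in> V" "norm e = 1" "f e = \<mu> *\<^sub>R e"
      using self_adjoint_eigenvector_exists[OF lin adj sub inv False] by metis
    have ee: "e \<bullet> e = 1" using e by (simp add: dot_square_norm)
    define W where "W = {x \<in> V. e \<bullet> x = 0}"
    have subW: "subspace W"
      using sub by (auto simp: W_def subspace_def inner_simps)
    have invW: "f x \<in> W" if "x \<in> W" for x
      using that inv adj[of e x] e(3) by (auto simp: W_def)
    have "e \<notin> W" by (simp add: W_def ee)
    moreover have "W \<subseteq> V" by (auto simp: W_def)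
    ultimately have "W \<subset> V" using e(1) by blast
    then have "dim W < dim V"
      using dim_psubset[of W V] sub subW by (simp add: span_eq_iff[THEN iffD2])
    then obtain F where F: "orthonormal F" "span F = W" "\<forall>e\<in>F. \<exists>\<mu>. f e = \<mu> *\<^sub>R e"
      using less.hyps[OF _ subW invW] by blast
    have FW: "F \<subseteq> W" using F(2) span_superset by blast
    have "orthonormal (insert e F)"
      using F(1) FW e(2)
      by (auto simp: orthonormal_def pairwise_insert orthogonal_def W_def inner_commute)
    moreover have "span (insert e F) = V"
    proof
      show "span (insert e F) \<subseteq> V"
        using FW e(1) sub by (intro span_minimal) (auto simp: W_def)
      show "V \<subseteq> span (insert e F)"
      proof
        fix x assume "x \<in> V"
        then have "x - (e \<bullet> x) *\<^sub>R e \<in> W"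
          using e(1) ee sub by (simp add: W_def inner_simps subspace_diff subspace_scale)
        then show "x \<in> span (insert e F)" using F(2) by (auto simp: span_insert)
      qed
    qed
    ultimately show ?thesis using F(3) e(3) by blast
  qed
qed

section \<open>Symmetric matrices\<close>

lemma symmetric_matrix_inner:
  fixes A :: "real^'n^'n"
  assumes "transpose A = A"
  shows "(A *v x) \<bullet> y = x \<bullet> (A *v y)"
  by (metis assms dot_lmul_matrix vector_transpose_matrix)

lemma symmetric_matrix_eigenbasis:
  fixes A :: "real^'n^'n"
  assumes "transpose A = A"
  obtains E :: "(real^'n) set" and \<mu> where
    "orthonormal E" "span E = UNIV" "\<And>e. e \<in> E \<Longrightarrow> A *v e = \<mu> e *\<^sub>R e"
proof -
  obtain E where "orthonormal E" "span E = UNIV" "\<forall>e\<in>E. \<exists>\<mu>. A *v e = \<mu> *\<^sub>R e"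
    using self_adjoint_eigenbasis_subspace[of "(*v) A" UNIV] symmetric_matrix_inner[OF assms]
    by (metis UNIV_I matrix_vector_mul_linear subspace_UNIV)
  then show thesis using that by metis
qed

lemma orthonormal_finite: "orthonormal E \<Longrightarrow> finite E"
  for E :: "'a::euclidean_space set"
  by (simp add: orthonormal_def pairwise_orthogonal_imp_finite)

lemma orthonormal_inner:
  "orthonormal E \<Longrightarrow> a \<in> E \<Longrightarrow> b \<in> E \<Longrightarrow> a \<bullet> b = (if a = b then 1 else 0)"
  by (auto simp: orthonormal_def pairwise_def orthogonal_def dot_square_norm)

lemma orthonormal_expand:
  fixes E :: "'a::euclidean_space set"
  assumes "orthonormal E" "span E = UNIV"
  shows "(\<Sum>e\<in>E. (x \<bullet> e) *\<^sub>R e) = x"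
  using assms orthonormal_finite[OF assms(1)]
  by (intro orthonormal_basis_expand) (auto simp: orthonormal_def)

text \<open>
  The trace does not depend on the orthonormal basis, since
  $\sum_e e_i e_j = \delta_{ij}$ for every orthonormal basis.
\<close>
lemma trace_eq_sum_orthonormal:
  fixes A :: "real^'n^'n"
  assumes E: "orthonormal E" "span E = UNIV"
  shows "trace A = (\<Sum>e\<in>E. e \<bullet> (A *v e))"
proof -
  have delta: "(\<Sum>e\<in>E. e $ i * e $ j) = (if i = j then 1 else 0)" for i j
  proof -
    have "(\<Sum>e\<in>E. e $ i * e $ j) = (\<Sum>e\<in>E. (axis i 1 \<bullet> e) *\<^sub>R e) $ j"
      by (simp add: inner_axis')
    also have "\<dots> = (if i = j then 1 else 0)"
      by (simp add: orthonormal_expand[OF E] axis_def)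
    finally show ?thesis .
  qed
  have "(\<Sum>e\<in>E. e \<bullet> (A *v e)) = (\<Sum>e\<in>E. \<Sum>i\<in>UNIV. \<Sum>j\<in>UNIV. A $ i $ j * (e $ i * e $ j))"
    by (simp add: inner_vec_def matrix_vector_mult_def sum_distrib_left mult_ac)
  also have "\<dots> = (\<Sum>i\<in>UNIV. \<Sum>j\<in>UNIV. \<Sum>e\<in>E. A $ i $ j * (e $ i * e $ j))"
    by (subst sum.swap, rule sum.cong[OF refl], rule sum.swap)
  also have "\<dots> = (\<Sum>i\<in>UNIV. \<Sum>j\<in>UNIV. A $ i $ j * (if i = j then 1 else 0))"
    by (simp add: sum_distrib_left[symmetric] delta)
  also have "\<dots> = trace A" by (simp add: trace_def if_distrib cong: if_cong)
  finally show ?thesis ..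
qed

section \<open>The positive semidefinite square root\<close>

text \<open>
  On an eigenvector $e$ of $B$ with eigenvalue $b \ge 0$, the vector $w = C e - b e$ satisfies
  $C w = - b w$, because $C^2 e = B^2 e = b^2 e$. As $C$ has no negative eigenvalue, this
  forces $w = 0$ when $b > 0$; when $b = 0$ it says $C^2 e = 0$, whence $C e = 0$.
  So $B$ and $C$ agree on an eigenbasis of $B$.
\<close>
lemma psd_square_root_unique:
  fixes B C :: "real^'n^'n"
  assumes B: "psd B" and C: "psd C" and eq: "B ** B = C ** C"
  shows "B = C"
proof -
  have symC: "transpose C = C" using C by (simp add: psd_def)
  obtain E \<mu> where E: "orthonormal E" "span E = UNIV"
    and eig: "\<And>e. e \<in> E \<Longrightarrow> B *v e = \<mu> e *\<^sub>R e"
    using symmetric_matrix_eigenbasis B by (metis psd_def)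
  have agree: "B *v e = C *v e" if e: "e \<in> E" for e
  proof -
    define b where "b = \<mu> e"
    have Be: "B *v e = b *\<^sub>R e" using eig e by (simp add: b_def)
    have "e \<bullet> (B *v e) \<ge> 0" using B by (simp add: psd_def)
    then have b0: "b \<ge> 0" using e orthonormal_inner[OF E(1), of e e] by (simp add: Be)
    have CC: "C *v (C *v e) = (b * b) *\<^sub>R e"
      by (metis Be eq matrix_vector_mul_assoc matrix_vector_mult_scaleR scaleR_scaleR)
    define w where "w = C *v e - b *\<^sub>R e"
    have Cw: "C *v w = (- b) *\<^sub>R w"
      by (simp add: w_def matrix_vector_mult_diff_distrib matrix_vector_mult_scaleR CC
          algebra_simps)
    have "w = 0"
    proof (cases "b = 0")
      case True
      then have "w \<bullet> w = e \<bullet> (C *v (C *v e))"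
        by (simp add: w_def symmetric_matrix_inner[OF symC])
      then show ?thesis using CC True by simp
    next
      case False
      have "0 \<le> w \<bullet> (C *v w)" using C by (simp add: psd_def)
      also have "\<dots> = - (b * (w \<bullet> w))" by (simp add: Cw)
      finally have "w \<bullet> w \<le> 0" using b0 False by (simp add: mult_le_0_iff)
      then show ?thesis by (metis inner_ge_zero inner_eq_zero_iff order_antisym)
    qed
    then show ?thesis using Be by (simp add: w_def)
  qed
  have "B *v x = C *v x" for x
    by (rule linear_eq_on[of "(*v) B" "(*v) C" x E]) (auto simp: E agree)
  then show ?thesis by (simp add: matrix_eq)
qed

lemma psd_square_root_exists:
  fixes A :: "real^'n^'n"
  assumes A: "psd A"
  shows "\<exists>B. psd B \<and> B ** B = A"
proof -
  obtain E \<mu> where E: "orthonormal E" "span E = UNIV"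
    and eig: "\<And>e. e \<in> E \<Longrightarrow> A *v e = \<mu> e *\<^sub>R e"
    using symmetric_matrix_eigenbasis A by (metis psd_def)
  have pos: "\<mu> e \<ge> 0" if "e \<in> E" for e
  proof -
    have "e \<bullet> (A *v e) \<ge> 0" using A by (simp add: psd_def)
    then show ?thesis using that orthonormal_inner[OF E(1), of e e] by (simp add: eig)
  qed
  define B :: "real^'n^'n" where "B = (\<chi> i j. \<Sum>e\<in>E. sqrt (\<mu> e) * e $ i * e $ j)"
  have Bv: "B *v x = (\<Sum>e\<in>E. (sqrt (\<mu> e) * (x \<bullet> e)) *\<^sub>R e)" for x
    unfolding vec_eq_iff
    by (auto simp: B_def matrix_vector_mult_def inner_vec_def sum_distrib_left sum_distrib_right
        mult_ac intro: sum.swap)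
  have Be: "B *v e = sqrt (\<mu> e) *\<^sub>R e" if "e \<in> E" for e
  proof -
    have "B *v e = (\<Sum>d\<in>E. if d = e then sqrt (\<mu> e) *\<^sub>R e else 0)"
      unfolding Bv by (rule sum.cong) (auto simp: orthonormal_inner[OF E(1)] that)
    then show ?thesis using that orthonormal_finite[OF E(1)] by simp
  qed
  have "transpose B = B" by (simp add: B_def transpose_def vec_eq_iff mult_ac)
  moreover have "x \<bullet> (B *v x) \<ge> 0" for x
  proof -
    have "x \<bullet> (B *v x) = (\<Sum>e\<in>E. sqrt (\<mu> e) * (x \<bullet> e)\<^sup>2)"
      by (simp add: Bv inner_sum_right power2_eq_square mult_ac)
    then show ?thesis by (simp add: sum_nonneg pos)
  qed
  moreover have "B ** B = A"
  proof -
    have "(B ** B) *v x = A *v x" for x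
    proof (rule linear_eq_on[of "(*v) (B ** B)" "(*v) A" x E])
      fix e assume "e \<in> E"
      then show "(B ** B) *v e = A *v e"
        by (simp add: matrix_vector_mul_assoc[symmetric] Be eig matrix_vector_mult_scaleR pos)
    qed (auto simp: E)
    then show ?thesis by (simp add: matrix_eq)
  qed
  ultimately show ?thesis by (auto simp: psd_def)
qed

lemma
  fixes A :: "real^'n^'n"
  assumes "psd A"
  shows psd_msqrt: "psd (msqrt A)" and msqrt_square: "msqrt A ** msqrt A = A"
proof -
  have "\<exists>!B. psd B \<and> B ** B = A"
    using psd_square_root_exists[OF assms] psd_square_root_unique by metis
  from theI'[OF this] show "psd (msqrt A)" "msqrt A ** msqrt A = A"
    by (simp_all add: msqrt_def)
qed

lemma pd_imp_psd: "pd A \<Longrightarrow> psd A"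
  unfolding pd_def psd_def by (metis inner_zero_left less_eq_real_def)

lemma invertible_msqrt:
  fixes M :: "real^'n^'n"
  assumes "pd M"
  shows "invertible (msqrt M)"
proof -
  have "x = 0" if "msqrt M *v x = 0" for x
  proof -
    have "M *v x = 0"
      using that msqrt_square[OF pd_imp_psd[OF assms]]
      by (metis matrix_vector_mul_assoc matrix_vector_mult_0_right)
    then show ?thesis using assms by (metis inner_zero_right less_irrefl pd_def)
  qed
  then show ?thesis by (simp add: invertible_left_inverse matrix_left_invertible_ker)
qed

lemma invertible_matrix_inv:
  fixes S :: "real^'n^'n"
  assumes "invertible S"
  shows "S ** matrix_inv S = mat 1" "matrix_inv S ** S = mat 1"
  using assms someI_ex[of "\<lambda>B. S ** B = mat 1 \<and> B ** S = mat 1"]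
  by (auto simp: invertible_def matrix_inv_def)

lemma symmetric_matrix_inv:
  fixes S :: "real^'n^'n"
  assumes "transpose S = S" "invertible S"
  shows "transpose (matrix_inv S) = matrix_inv S"
proof -
  let ?T = "matrix_inv S"
  note inv = invertible_matrix_inv[OF assms(2)]
  have "transpose ?T ** S = mat 1"
    by (metis assms(1) inv(1) matrix_transpose_mul transpose_mat)
  then show ?thesis by (metis inv(1) matrix_mul_assoc matrix_mul_lid matrix_mul_rid)
qed

text \<open>
  Traces are compared in an orthonormal eigenbasis of $K$ rather than of $L$: there the lengths
  $\|K e\|$ are the eigenvalues of $K$, so they sum up to its trace, while
  $e \cdot L e \le \|L e\|$ holds for every unit vector.
\<close>
lemma trace_le_if_norm_le:
  fixes K L :: "real^'n^'n"
  assumes K: "psd K" and le: "\<And>x. norm (L *v x) \<le> norm (K *v x)"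
  shows "trace L \<le> trace K"
proof -
  obtain E \<mu> where E: "orthonormal E" "span E = UNIV"
    and eig: "\<And>e. e \<in> E \<Longrightarrow> K *v e = \<mu> e *\<^sub>R e"
    using symmetric_matrix_eigenbasis K by (metis psd_def)
  have "e \<bullet> (L *v e) \<le> e \<bullet> (K *v e)" if e: "e \<in> E" for e
  proof -
    have ne: "norm e = 1" using E(1) e by (simp add: orthonormal_def)
    have "e \<bullet> (K *v e) = \<mu> e" using orthonormal_inner[OF E(1), of e e] e by (simp add: eig)
    moreover have "e \<bullet> (K *v e) \<ge> 0" using K by (simp add: psd_def)
    ultimately have "norm (K *v e) = e \<bullet> (K *v e)" using eig[OF e] ne by (metis abs_of_nonneg mult.right_neutral norm_scaleR)
    moreover have "e \<bullet> (L *v e) \<le> norm (L *v e)"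
      using norm_cauchy_schwarz[of e "L *v e"] ne by simp
    ultimately show ?thesis using le[of e] by simp
  qed
  then show ?thesis unfolding trace_eq_sum_orthonormal[OF E] by (rule sum_mono)
qed

section \<open>Block matrices and the feasible set\<close>

lemma sum_UNIV_Plus:
  fixes f :: "'a::finite + 'b::finite \<Rightarrow> 'c::comm_monoid_add"
  shows "sum f UNIV = (\<Sum>a\<in>UNIV. f (Inl a)) + (\<Sum>b\<in>UNIV. f (Inr b))"
  using sum.Plus[of "UNIV :: 'a set" "UNIV :: 'b set" f] by (simp add: comp_def)

lemma block_matrix_quadratic_form:
  fixes A :: "real^'n^'n" and D :: "real^'k^'k" and z :: "real^('n + 'k)"
  defines "u \<equiv> \<chi> i. z $ Inl i" and "v \<equiv> \<chi> j. z $ Inr j"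
  shows "z \<bullet> (block_matrix A B C D *v z)
      = u \<bullet> (A *v u) + u \<bullet> (B *v v) + v \<bullet> (C *v u) + v \<bullet> (D *v v)"
  by (simp add: u_def v_def inner_vec_def matrix_vector_mult_def block_matrix_def sum_UNIV_Plus
      distrib_left sum.distrib)

lemma transpose_block_matrix:
  "transpose (block_matrix A B C D)
    = block_matrix (transpose A) (transpose C) (transpose B) (transpose D)"
  by (auto simp: block_matrix_def transpose_def vec_eq_iff split: sum.splits)

text \<open>
  The Schur complement of the identity block: the quadratic form of the block matrix is
  $u \cdot N u - \|B^T u\|^2 + \|B^T u + v\|^2$, and for fixed $u$ its minimum over $v$ is
  attained at $v = - B^T u$.
\<close>
lemma psd_block_matrix_identity_iff:
  fixes N :: "real^'n^'n" and B :: "real^'k^'n"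
  assumes N: "transpose N = N"
  shows "psd (block_matrix N B (transpose B) (mat 1))
    \<longleftrightarrow> (\<forall>u. (norm (transpose B *v u))\<^sup>2 \<le> u \<bullet> (N *v u))"
proof -
  let ?Z = "block_matrix N B (transpose B) (mat 1)"
  have form: "z \<bullet> (?Z *v z) = u \<bullet> (N *v u) - (norm (transpose B *v u))\<^sup>2
      + (norm (transpose B *v u + v))\<^sup>2"
    if "u = (\<chi> i. z $ Inl i)" "v = (\<chi> j. z $ Inr j)" for z u v
  proof -
    have "u \<bullet> (B *v v) = (transpose B *v u) \<bullet> v"
      by (metis dot_lmul_matrix transpose_matrix_vector)
    then show ?thesis
      unfolding block_matrix_quadratic_form that[symmetric]
      by (simp add: power2_norm_eq_inner inner_simps inner_commute)
  qed
  have sym: "transpose ?Z = ?Z" by (simp add: transpose_block_matrix N)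
  show ?thesis
  proof
    assume psd: "psd ?Z"
    show "\<forall>u. (norm (transpose B *v u))\<^sup>2 \<le> u \<bullet> (N *v u)"
    proof
      fix u
      define v where "v = - (transpose B *v u)"
      define z :: "real^('n + 'k)" where
        "z = (\<chi> i. case i of Inl a \<Rightarrow> u $ a | Inr b \<Rightarrow> v $ b)"
      have "z \<bullet> (?Z *v z) \<ge> 0" using psd by (simp add: psd_def)
      then show "(norm (transpose B *v u))\<^sup>2 \<le> u \<bullet> (N *v u)"
        using form[of u z v] by (simp add: z_def) (simp add: v_def)
    qed
  next
    assume "\<forall>u. (norm (transpose B *v u))\<^sup>2 \<le> u \<bullet> (N *v u)"
    then show "psd ?Z"
      using sym by (simp add: psd_def form[OF refl refl])
  qed
qed

text \<open>
  With $S = \sqrt M$ and $x = S z$, the Schur complement condition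
  $\|L S^{-1} x\|^2 \le x \cdot N x$ becomes a comparison of $L$ with the square root of $S N S$.
\<close>
lemma
  fixes M N L :: "real^'n^'n"
  assumes M: "pd M" and N: "psd N"
  defines "K \<equiv> msqrt (msqrt M ** N ** msqrt M)"
  shows psd_msqrt_product: "psd K"
    and feasible_iff_norm_le:
      "L \<in> feasible N M \<longleftrightarrow> psd L \<and> (\<forall>z. norm (L *v z) \<le> norm (K *v z))"
proof -
  define S where "S = msqrt M"
  define T where "T = matrix_inv S"
  have symS: "transpose S = S"
    using psd_msqrt[OF pd_imp_psd[OF M]] by (simp add: S_def psd_def)
  have invS: "invertible S" using invertible_msqrt[OF M] by (simp add: S_def)
  have TS: "T ** S = mat 1" and ST: "S ** T = mat 1"
    using invertible_matrix_inv[OF invS] by (simp_all add: T_def)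
  have symT: "transpose T = T" using symmetric_matrix_inv[OF symS invS] by (simp add: T_def)
  have symN: "transpose N = N" using N by (simp add: psd_def)
  have SNS: "z \<bullet> ((S ** N ** S) *v z) = (S *v z) \<bullet> (N *v (S *v z))" for z
    by (simp add: matrix_vector_mul_assoc[symmetric] symmetric_matrix_inner[OF symS])
  have psdP: "psd (S ** N ** S)"
    using N by (simp add: psd_def SNS) (simp add: matrix_transpose_mul symS matrix_mul_assoc)
  show psdK: "psd K" using psd_msqrt[OF psdP] by (simp add: K_def S_def)
  have normK: "(norm (K *v z))\<^sup>2 = (S *v z) \<bullet> (N *v (S *v z))" for z
  proof -
    have "(norm (K *v z))\<^sup>2 = z \<bullet> ((K ** K) *v z)"
      using psdK
      by (simp add: power2_norm_eq_inner psd_def symmetric_matrix_inner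
          matrix_vector_mul_assoc[symmetric])
    also have "K ** K = S ** N ** S" using msqrt_square[OF psdP] by (simp add: K_def S_def)
    finally show ?thesis by (simp add: SNS)
  qed
  have "psd (block_matrix N (T ** L) (L ** T) (mat 1)) \<longleftrightarrow> (\<forall>z. norm (L *v z) \<le> norm (K *v z))"
    if L: "transpose L = L"
  proof -
    have trTL: "transpose (T ** L) = L ** T" by (simp add: matrix_transpose_mul L symT)
    have "psd (block_matrix N (T ** L) (L ** T) (mat 1))
        \<longleftrightarrow> (\<forall>u. (norm ((L ** T) *v u))\<^sup>2 \<le> u \<bullet> (N *v u))"
      using psd_block_matrix_identity_iff[OF symN, of "T ** L"] by (simp add: trTL)
    also have "\<dots> \<longleftrightarrow> (\<forall>z. (norm ((L ** T) *v (S *v z)))\<^sup>2 \<le> (S *v z) \<bullet> (N *v (S *v z)))"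
      by (metis ST matrix_vector_mul_assoc matrix_vector_mul_lid)
    also have "\<dots> \<longleftrightarrow> (\<forall>z. (norm (L *v z))\<^sup>2 \<le> (norm (K *v z))\<^sup>2)"
    proof -
      have "(L ** T) *v (S *v z) = L *v z" for z
        by (metis TS matrix_mul_assoc matrix_mul_rid matrix_vector_mul_assoc)
      then show ?thesis by (simp add: normK)
    qed
    finally show ?thesis by simp
  qed
  then show "L \<in> feasible N M \<longleftrightarrow> psd L \<and> (\<forall>z. norm (L *v z) \<le> norm (K *v z))"
    by (auto simp: feasible_def psd_def[of L] S_def T_def)
qed

theorem lemma3:
  fixes M N :: "real^'n^'n"
  assumes "pd M" and "psd N"
  shows "(\<exists>L\<in>feasible N M. \<phi> M N = - trace L) \<and> (\<forall>L\<in>feasible N M. \<phi> M N \<le> - trace L)"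
proof -
  note feasible = feasible_iff_norm_le[OF assms] and psdK = psd_msqrt_product[OF assms]
  show ?thesis
    unfolding \<phi>_def
    using psdK trace_le_if_norm_le[OF psdK] by (auto simp: feasible)
qed

end
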